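(* Consider a sequence (indexed by $N\to\infty$) of Bernoulli inference models with priors $\mathbf P$ satisfying replica weak separation (RWS). If the model has all-or-nothing at the exponential scale at some critical value $p_{\mathrm{AoN}}=p_{\mathrm{AoN}}(N)$, then $$\lim_{N\to\infty}\frac{\log p_{\mathrm{AoN}}}{\log p_{1M}}=1,$$ where $p_{1M}=M^{-1/K}$ is the first moment threshold. In other words, $p_{\mathrm{AoN}}=(p_{1M})^{1+o_N(1)}$.
   Context: Bernoulli inference model: let $1\le K=K(N)\le N$, let $\mathcal S$ be a family of $M=M(N)$ subsets of $[N]$ each of size $K$, and let the prior $\mathbf P$ be uniform on $\mathcal S$. Assume marginal symmetry: for $\mathbf S\sim\mathbf P$, $\mathbf P(i\in\mathbf S)=K/N$ for all $i\in[N]$. Under the planted model $\mathbb P_p$, $\mathbf S\sim\mathbf P$, $\theta^*=\mathbf 1_{\mathbf S}\in\{0,1\}^N$, $\mathbf V\subseteq[N]$ is an independent random subset containing each element independently with probability $p$, and one observes $\mathbf Y=\mathbf S\cup\mathbf V$. Set $\mathrm{MMSE}_N(p)=\mathbb E_{\mathbb P_p}\big[\|\theta^*-\mathbb E[\theta^*\mid\mathbf Y]\|_2^2\big]\in[0,K]$. AoN at the exponential scale with critical probability $p_{\mathrm{AoN}}=p_{\mathrm{AoN}}(N)\in(0,1)$, where $p_{\mathrm{AoN}}$ is required to stay bounded away from one: for every constant $\epsilon>0$, $\lim_{N\to\infty}\mathrm{MMSE}_N(p)/K=1$ for all $p=p_N\in[0,1]$ with $p_N\ge(p_{\mathrm{AoN}})^{1-\epsilon}$,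 and $\lim_{N\to\infty}\mathrm{MMSE}_N(p)/K=0$ for all $p=p_N\in[0,1]$ with $p_N\le(p_{\mathrm{AoN}})^{1+\epsilon}$. RWS: with $M\ge2$ (so that $\log M>0$), $$\lim_{\delta\downarrow0}\limsup_{N\to\infty}\frac1{\log M}\log\Big\{\mathbf P^{\otimes2}\big(|\mathbf S\cap\mathbf S'|\ge(1-\delta)K\big)\,M\Big\}=0,$$ where $\mathbf S,\mathbf S'$ are independent samples from $\mathbf P$. *)

theory Defs
  imports "HOL-Probability.Probability"
begin

text \<open>The ground set \<open>[N]\<close> is \<open>{1..N}\<close>; the number \<open>M\<close> of possible signals is \<open>card \<S>\<close>.\<close>

definition bernoulli_model :: "nat \<Rightarrow> nat \<Rightarrow> nat set set \<Rightarrow> bool" where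
  "bernoulli_model N K \<S> \<longleftrightarrow>
     1 \<le> K \<and> K \<le> N \<and> \<S> \<noteq> {} \<and> (\<forall>A\<in>\<S>. A \<subseteq> {1..N} \<and> card A = K) \<and>
     (\<forall>i\<in>{1..N}. measure_pmf.prob (pmf_of_set \<S>) {A. i \<in> A} = real K / real N)"

definition random_subset :: "nat \<Rightarrow> real \<Rightarrow> nat set pmf" where
  "random_subset N p =
     map_pmf (\<lambda>b. {i\<in>{1..N}. b i}) (Pi_pmf {1..N} False (\<lambda>_. bernoulli_pmf p))"

text \<open>Joint law of \<open>(S, V)\<close>; the observation is \<open>Y = S \<union> V\<close>.\<close>

definition planted :: "nat \<Rightarrow> nat set set \<Rightarrow> real \<Rightarrow> (nat set \<times> nat set) pmf" where
  "planted N \<S> p = pair_pmf (pmf_of_set \<S>) (random_subset N p)"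

definition observation :: "nat set \<times> nat set \<Rightarrow> nat set" where
  "observation = (\<lambda>(S, V). S \<union> V)"

definition signal :: "nat \<Rightarrow> nat set \<times> nat set \<Rightarrow> real" where
  "signal i = (\<lambda>(S, V). indicator S i)"

text \<open>The \<open>i\<close>-th coordinate of \<open>E[\<theta>* | Y]\<close>: conditional expectation with respect to the
  \<open>\<sigma>\<close>-algebra generated by \<open>Y\<close>.\<close>

definition posterior_mean ::
  "nat \<Rightarrow> nat set set \<Rightarrow> real \<Rightarrow> nat \<Rightarrow> nat set \<times> nat set \<Rightarrow> real" where
  "posterior_mean N \<S> p i =
     real_cond_exp (measure_pmf (planted N \<S> p))
       (vimage_algebra UNIV observation (count_space UNIV)) (signal i)"

definition MMSE :: "nat \<Rightarrow> nat set set \<Rightarrow> real \<Rightarrow> real" where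
  "MMSE N \<S> p =
     measure_pmf.expectation (planted N \<S> p)
       (\<lambda>\<omega>. (L2_set (\<lambda>i. signal i \<omega> - posterior_mean N \<S> p i \<omega>) {1..N})\<^sup>2)"

text \<open>In the asymptotic notions below, constraints are imposed only for all large \<open>N\<close>. This
  matters: a model needs \<open>N \<ge> 1\<close>, and \<open>M \<ge> 2\<close> is impossible for \<open>N = 1\<close>.\<close>

definition exp_scale_AoN ::
  "(nat \<Rightarrow> nat) \<Rightarrow> (nat \<Rightarrow> nat set set) \<Rightarrow> (nat \<Rightarrow> real) \<Rightarrow> bool" where
  "exp_scale_AoN K \<S> p_AoN \<longleftrightarrow>
     (\<forall>\<^sub>F N in sequentially. 0 < p_AoN N \<and> p_AoN N < 1) \<and>
     (\<exists>c<1. \<forall>\<^sub>F N in sequentially. p_AoN N \<le> c) \<and>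
     (\<forall>\<epsilon>>0.
        (\<forall>p. (\<forall>\<^sub>F N in sequentially. p N \<in> {0..1} \<and> p N \<ge> p_AoN N powr (1 - \<epsilon>)) \<longrightarrow>
             (\<lambda>N. MMSE N (\<S> N) (p N) / real (K N)) \<longlonglongrightarrow> 1) \<and>
        (\<forall>p. (\<forall>\<^sub>F N in sequentially. p N \<in> {0..1} \<and> p N \<le> p_AoN N powr (1 + \<epsilon>)) \<longrightarrow>
             (\<lambda>N. MMSE N (\<S> N) (p N) / real (K N)) \<longlonglongrightarrow> 0))"

definition overlap_prob :: "nat \<Rightarrow> nat set set \<Rightarrow> real \<Rightarrow> real" where
  "overlap_prob K \<S> \<delta> =
     measure_pmf.prob (pair_pmf (pmf_of_set \<S>) (pmf_of_set \<S>))
       {(S, S'). real (card (S \<inter> S')) \<ge> (1 - \<delta>) * real K}"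

definition RWS :: "(nat \<Rightarrow> nat) \<Rightarrow> (nat \<Rightarrow> nat set set) \<Rightarrow> bool" where
  "RWS K \<S> \<longleftrightarrow>
     (\<forall>\<^sub>F N in sequentially. card (\<S> N) \<ge> 2) \<and>
     ((\<lambda>\<delta>. limsup (\<lambda>N. ereal (1 / ln (real (card (\<S> N))) *
          ln (overlap_prob (K N) (\<S> N) \<delta> * real (card (\<S> N)))))) \<longlongrightarrow> 0) (at_right 0)"

definition p_1M :: "nat \<Rightarrow> nat set set \<Rightarrow> real" where
  "p_1M K \<S> = real (card \<S>) powr (- 1 / real K)"

end

theory Submission
  imports Defs
begin

text \<open>
  Write \<open>M\<close> for the number of signals and \<open>f p\<close> for the conditional entropy of the signal given the
  observation at noise level \<open>p\<close>. All signals contained in \<open>Y\<close> are equally likely under the posterior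
  (\<open>posterior_mean_eq\<close>), so \<open>f p\<close> is the mean of \<open>ln Z\<close>, where \<open>Z\<close> is the number of signals
  contained in \<open>Y\<close>. The theorem follows by comparing \<open>f\<close> with the MMSE on the scale of \<open>ln p\<close>.

  The threshold \<open>p_AoN\<close> cannot be much smaller than \<open>p_1M\<close>. As a function of \<open>ln p\<close>, the entropy \<open>f\<close>
  has slope at least the MMSE (\<open>conditional_entropy_derivative\<close>). It is nonnegative and equals \<open>ln M\<close>
  at \<open>p = 1\<close>. In the ``nothing'' phase the MMSE is about \<open>K\<close>, so the slope is about \<open>K\<close> all the way
  from \<open>p_AoN\<close> to \<open>1\<close>, which is possible only if \<open>K * (- ln p_AoN)\<close> is at most about \<open>ln M\<close>
  (\<open>log_card_ge_of_MMSE_ge\<close>).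

  The threshold \<open>p_AoN\<close> cannot be much larger than \<open>p_1M\<close> either. The observation carries at most
  \<open>K * (- ln p)\<close> of information, so \<open>f p \<ge> ln M + K * ln p\<close> (\<open>conditional_entropy_ge\<close>). In the ``all''
  phase the MMSE is negligible, so most signals contained in \<open>Y\<close> nearly coincide with the true one.
  By weak separation there are only \<open>M\<close> to the power \<open>o(1)\<close> such signals on average, so \<open>f p\<close> is
  small compared with \<open>ln M\<close> (\<open>conditional_entropy_le\<close>). Hence \<open>K * (- ln p)\<close> is at least about
  \<open>ln M\<close> for \<open>p\<close> just below \<open>p_AoN\<close>.
\<close>

section \<open>Finite sums over observations\<close>

definition compatible :: "nat set set \<Rightarrow> nat set \<Rightarrow> nat set set" where
  "compatible \<S> Y = {A \<in> \<S>. A \<subseteq> Y}"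

text \<open>This is the probability of observing \<open>Y\<close> given any one signal \<open>A \<subseteq> Y\<close>. It is the same for all of
  them, which is why the posterior is uniform on the compatible signals. The truncated subtraction
  in the exponents is harmless, since \<open>K \<le> card Y \<le> N\<close> as soon as some signal is compatible.\<close>

definition likelihood :: "nat \<Rightarrow> nat \<Rightarrow> real \<Rightarrow> nat set \<Rightarrow> real" where
  "likelihood N K p Y = p ^ (card Y - K) * (1 - p) ^ (N - card Y)"

definition posterior_prob :: "nat set set \<Rightarrow> nat set \<Rightarrow> nat \<Rightarrow> real" where
  "posterior_prob \<S> Y i =
     real (card {A \<in> compatible \<S> Y. i \<in> A}) / real (card (compatible \<S> Y))"

lemma sum_Pow_binomial_weights:
  fixes p :: real
  assumes "finite A"
  shows "(\<Sum>X\<in>Pow A. p ^ card X * (1 - p) ^ card (A - X)) = 1"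
proof -
  have "(\<Sum>X\<in>Pow A. p ^ card X * (1 - p) ^ card (A - X)) = (\<Prod>x\<in>A. p + (1 - p))"
    using prod_add[OF assms, of "\<lambda>_. p" "\<lambda>_. 1 - p"] by simp
  thus ?thesis by simp
qed

lemma pmf_random_subset:
  assumes p: "p \<in> {0..1}" and V: "V \<subseteq> {1..N}"
  shows "pmf (random_subset N p) V = p ^ card V * (1 - p) ^ card ({1..N} - V)"
proof -
  define P where "P = Pi_pmf {1..N} False (\<lambda>_. bernoulli_pmf p)"
  have supp: "set_pmf P \<subseteq> {f. \<forall>x. x \<notin> {1..N} \<longrightarrow> f x = False}"
    unfolding P_def by (rule set_Pi_pmf_subset) simp
  have "pmf (random_subset N p) V = measure_pmf.prob P ((\<lambda>b. {i\<in>{1..N}. b i}) -` {V})"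
    by (simp add: random_subset_def pmf_map P_def)
  also have "\<dots> = measure_pmf.prob P ((\<lambda>b. {i\<in>{1..N}. b i}) -` {V} \<inter> set_pmf P)"
    by (simp add: measure_Int_set_pmf)
  also have "(\<lambda>b. {i\<in>{1..N}. b i}) -` {V} \<inter> set_pmf P = {\<lambda>i. i \<in> V} \<inter> set_pmf P"
    using supp V by fastforce
  also have "measure_pmf.prob P \<dots> = pmf P (\<lambda>i. i \<in> V)"
    by (simp add: measure_Int_set_pmf measure_pmf_single)
  also have "\<dots> = (\<Prod>i\<in>{1..N}. pmf (bernoulli_pmf p) (i \<in> V))"
    unfolding P_def using V by (subst pmf_Pi') auto
  also have "\<dots> = (\<Prod>i\<in>{1..N}. if i \<in> V then p else 1 - p)"
    using p by (intro prod.cong) auto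
  also have "\<dots> = (\<Prod>i\<in>{1..N} \<inter> V. p) * (\<Prod>i\<in>{1..N} - V. 1 - p)"
    by (subst prod.If_cases) (auto simp: Diff_eq Collect_neg_eq)
  also have "{1..N} \<inter> V = V" using V by blast
  finally show ?thesis by simp
qed

lemma set_pmf_random_subset: "set_pmf (random_subset N p) \<subseteq> Pow {1..N}"
  by (auto simp: random_subset_def)

text \<open>The posterior is uniform on the compatible signals, so the conditional entropy \<open>H(S | Y)\<close> is the
  mean of the logarithm of their number. An observation \<open>Y\<close> with \<open>Z\<close> compatible signals has
  probability \<open>Z * likelihood / card \<S>\<close>, whence the weight \<open>Z\<close>.\<close>

definition conditional_entropy :: "nat \<Rightarrow> nat \<Rightarrow> nat set set \<Rightarrow> real \<Rightarrow> real" where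
  "conditional_entropy N K \<S> p =
     (\<Sum>Y\<in>Pow {1..N}. likelihood N K p Y *
        (real (card (compatible \<S> Y)) * ln (real (card (compatible \<S> Y))))) / real (card \<S>)"

lemma likelihood_nonneg: "p \<in> {0..1} \<Longrightarrow> 0 \<le> likelihood N K p Y"
  by (simp add: likelihood_def)

text \<open>The boundary terms in the derivative of a product measure are indexed by a set and a point outside
  it; adding the point to the set turns them into terms indexed by a set and a point inside it.\<close>

lemma sum_Pow_remove_element:
  fixes H :: "'a set \<Rightarrow> 'a \<Rightarrow> real"
  assumes "finite U"
  shows "(\<Sum>Y\<in>Pow U. \<Sum>i\<in>U - Y. H Y i) = (\<Sum>Y\<in>Pow U. \<Sum>i\<in>Y. H (Y - {i}) i)"
proof -
  have fin: "finite Y" if "Y \<in> Pow U" for Y using that assms finite_subset by auto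
  have "(\<Sum>Y\<in>Pow U. \<Sum>i\<in>U - Y. H Y i) = (\<Sum>(Y, i)\<in>(SIGMA Y:Pow U. U - Y). H Y i)"
    using assms by (subst sum.Sigma) auto
  also have "\<dots> = (\<Sum>(Y, i)\<in>(SIGMA Y:Pow U. Y). H (Y - {i}) i)"
    by (rule sum.reindex_bij_witness[where i = "\<lambda>(Y, i). (Y - {i}, i)" and j = "\<lambda>(Y, i). (insert i Y, i)"])
       auto
  also have "\<dots> = (\<Sum>Y\<in>Pow U. \<Sum>i\<in>Y. H (Y - {i}) i)"
    using assms fin by (subst sum.Sigma) auto
  finally show ?thesis .
qed

locale uniform_prior =
  fixes N K :: nat and \<S> :: "nat set set"
  assumes K_pos: "1 \<le> K"
    and nonempty: "\<S> \<noteq> {}"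
    and subset: "A \<in> \<S> \<Longrightarrow> A \<subseteq> {1..N}"
    and card_eq: "A \<in> \<S> \<Longrightarrow> card A = K"
begin

lemma finite_prior: "finite \<S>"
  by (rule finite_subset[of _ "Pow {1..N}"]) (use subset in auto)

lemma finite_compatible: "finite (compatible \<S> Y)"
  using finite_prior by (simp add: compatible_def)

lemma finite_member: "A \<in> \<S> \<Longrightarrow> finite A"
  using subset finite_subset by blast

lemma card_prior_pos: "card \<S> > 0"
  using nonempty finite_prior by (simp add: card_gt_0_iff)

lemma compatible_le_prior: "card (compatible \<S> Y) \<le> card \<S>"
  using finite_prior by (auto simp: compatible_def intro: card_mono)

text \<open>Once \<open>Y = A \<union> V\<close> is known, the part of the noise that falls inside \<open>A\<close> is free and its weights add
  up to one.\<close>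

lemma sum_over_noise:
  fixes G :: "nat set \<Rightarrow> real"
  assumes A: "A \<in> \<S>"
  shows "(\<Sum>V\<in>Pow {1..N}. p ^ card V * (1 - p) ^ card ({1..N} - V) * G (A \<union> V)) =
         (\<Sum>Y | A \<subseteq> Y \<and> Y \<subseteq> {1..N}. likelihood N K p Y * G Y)"
proof -
  note A' = subset[OF A] card_eq[OF A] finite_member[OF A]
  let ?YS = "{Y. A \<subseteq> Y \<and> Y \<subseteq> {1..N}}"
  let ?w = "\<lambda>V. p ^ card V * (1 - p) ^ card ({1..N} - V)"
  \<comment> \<open>A noise set is determined by the observation and by its trace \<open>T\<close> on the signal.\<close>
  have bij: "bij_betw (\<lambda>(Y, T). (Y - A) \<union> T) (?YS \<times> Pow A) (Pow {1..N})"
    by (rule bij_betwI[where g = "\<lambda>V. (A \<union> V, A \<inter> V)"]) (use A' in auto)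
  have "(\<Sum>V\<in>Pow {1..N}. ?w V * G (A \<union> V)) =
        (\<Sum>(Y, T)\<in>?YS \<times> Pow A. ?w ((Y - A) \<union> T) * G (A \<union> ((Y - A) \<union> T)))"
    by (subst sum.reindex_bij_betw[OF bij, symmetric]) (simp add: case_prod_unfold)
  also have "\<dots> = (\<Sum>(Y, T)\<in>?YS \<times> Pow A.
      (likelihood N K p Y * G Y) * (p ^ card T * (1 - p) ^ card (A - T)))"
  proof (intro sum.cong refl, clarify)
    fix Y T assume Y: "A \<subseteq> Y" "Y \<subseteq> {1..N}" and T: "T \<subseteq> A"
    have fY: "finite Y" using Y finite_subset by blast
    have fT: "finite T" using T A' finite_subset by blast
    have "card ((Y - A) \<union> T) = card (Y - A) + card T"
      using fY fT T by (intro card_Un_disjoint) auto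
    also have "card (Y - A) = card Y - K" using A' Y by (simp add: card_Diff_subset)
    finally have c1: "card ((Y - A) \<union> T) = card Y - K + card T" .
    have "{1..N} - ((Y - A) \<union> T) = ({1..N} - Y) \<union> (A - T)" using Y T A' by auto
    hence "card ({1..N} - ((Y - A) \<union> T)) = card ({1..N} - Y) + card (A - T)"
      using A' Y by (simp only:) (intro card_Un_disjoint, auto)
    also have "card ({1..N} - Y) = N - card Y" using Y fY by (simp add: card_Diff_subset)
    finally have c2: "card ({1..N} - ((Y - A) \<union> T)) = N - card Y + card (A - T)" .
    have "A \<union> ((Y - A) \<union> T) = Y" using Y T by auto
    thus "?w ((Y - A) \<union> T) * G (A \<union> ((Y - A) \<union> T)) =
      (likelihood N K p Y * G Y) * (p ^ card T * (1 - p) ^ card (A - T))"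
      by (simp only: c1 c2 likelihood_def power_add) (simp add: mult_ac)
  qed
  also have "\<dots> = (\<Sum>Y\<in>?YS. likelihood N K p Y * G Y) *
                   (\<Sum>T\<in>Pow A. p ^ card T * (1 - p) ^ card (A - T))"
    by (simp add: sum_product sum.cartesian_product)
  finally show ?thesis using A' by (simp add: sum_Pow_binomial_weights)
qed

lemma sum_compatible_swap:
  fixes H :: "nat set \<Rightarrow> nat set \<Rightarrow> real"
  shows "(\<Sum>A\<in>\<S>. \<Sum>Y | A \<subseteq> Y \<and> Y \<subseteq> {1..N}. H A Y) =
         (\<Sum>Y\<in>Pow {1..N}. \<Sum>A\<in>compatible \<S> Y. H A Y)"
proof -
  have "(\<Sum>A\<in>\<S>. \<Sum>Y | A \<subseteq> Y \<and> Y \<subseteq> {1..N}. H A Y) =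
        (\<Sum>A\<in>\<S>. \<Sum>Y\<in>{Y\<in>Pow {1..N}. A \<subseteq> Y}. H A Y)"
    by (intro sum.cong) auto
  also have "\<dots> = (\<Sum>Y\<in>Pow {1..N}. \<Sum>A\<in>{A\<in>\<S>. A \<subseteq> Y}. H A Y)"
    using finite_prior by (intro sum.swap_restrict) auto
  finally show ?thesis by (simp add: compatible_def)
qed

lemma finite_set_pmf_planted: "finite (set_pmf (planted N \<S> p))"
  using finite_prior nonempty set_pmf_random_subset[of N p]
  by (auto simp: planted_def intro!: finite_cartesian_product intro: finite_subset)

text \<open>Expectations under the planted model become finite sums over the observation \<open>Y\<close> and the signals
  compatible with it, with a weight that depends on \<open>Y\<close> alone.\<close>

lemma expectation_planted:
  fixes F :: "nat set \<Rightarrow> nat set \<Rightarrow> real"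
  assumes p: "p \<in> {0..1}"
  shows "measure_pmf.expectation (planted N \<S> p) (\<lambda>\<omega>. F (fst \<omega>) (observation \<omega>)) =
         (\<Sum>Y\<in>Pow {1..N}. likelihood N K p Y * (\<Sum>A\<in>compatible \<S> Y. F A Y)) / real (card \<S>)"
proof -
  have "measure_pmf.expectation (planted N \<S> p) (\<lambda>\<omega>. F (fst \<omega>) (observation \<omega>)) =
    (\<Sum>\<omega>\<in>\<S> \<times> Pow {1..N}. F (fst \<omega>) (observation \<omega>) * pmf (planted N \<S> p) \<omega>)"
    using finite_prior nonempty set_pmf_random_subset[of N p]
    by (intro integral_measure_pmf_real) (auto simp: planted_def)
  also have "\<dots> = (\<Sum>\<omega>\<in>\<S> \<times> Pow {1..N}. 1 / real (card \<S>) *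
     (case \<omega> of (A, V) \<Rightarrow> p ^ card V * (1 - p) ^ card ({1..N} - V) * F A (A \<union> V)))"
    using p by (intro sum.cong refl)
      (auto simp: planted_def pmf_pair pmf_random_subset observation_def
         pmf_of_set[OF nonempty finite_prior])
  also have "\<dots> = (\<Sum>A\<in>\<S>. \<Sum>V\<in>Pow {1..N}.
       p ^ card V * (1 - p) ^ card ({1..N} - V) * F A (A \<union> V)) / real (card \<S>)"
    unfolding sum.cartesian_product by (simp add: sum_divide_distrib case_prod_unfold)
  also have "\<dots> = (\<Sum>A\<in>\<S>. \<Sum>Y | A \<subseteq> Y \<and> Y \<subseteq> {1..N}. likelihood N K p Y * F A Y) / real (card \<S>)"
    using sum_over_noise[of _ p "F _"]
    by (intro arg_cong2[where f = "(/)"] sum.cong[OF refl, of \<S>] refl) blast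
  also have "\<dots> = (\<Sum>Y\<in>Pow {1..N}. likelihood N K p Y * (\<Sum>A\<in>compatible \<S> Y. F A Y)) / real (card \<S>)"
    by (simp add: sum_compatible_swap sum_distrib_left del: One_nat_def)
  finally show ?thesis .
qed

section \<open>The posterior mean and the MMSE\<close>

lemma sum_indicator_compatible:
  "(\<Sum>A\<in>compatible \<S> Y. indicator A i) = real (card {A \<in> compatible \<S> Y. i \<in> A})"
  using finite_compatible[of Y] by (simp add: indicator_def sum.If_cases Int_def)

text \<open>The defining property of conditional expectation is checked on the events \<open>Y \<in> B\<close>: given \<open>Y\<close>, both
  sides sum to the number of compatible signals that contain \<open>i\<close>.\<close>

lemma posterior_mean_eq:
  assumes p: "p \<in> {0..1}"
  shows "AE \<omega> in measure_pmf (planted N \<S> p).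
           posterior_mean N \<S> p i \<omega> = posterior_prob \<S> (observation \<omega>) i"
proof -
  let ?M = "measure_pmf (planted N \<S> p)"
  let ?F = "vimage_algebra UNIV observation (count_space UNIV)"
  interpret finite_measure_subalgebra ?M ?F
    by unfold_locales (auto simp: subalgebra_def measure_pmf.emeasure_space_1 intro!: exI[of _ "{UNIV}"])
  have meas: "observation \<in> measurable ?F (count_space UNIV)"
    by (rule measurable_vimage_algebra1) simp
  show ?thesis unfolding posterior_mean_def
  proof (rule real_cond_exp_charact)
    fix E assume "E \<in> sets ?F"
    then obtain B where E: "E = observation -` B"
      by (auto simp: sets_vimage_algebra2)
    have eqP: "(\<Sum>A\<in>compatible \<S> Y. indicator B Y * indicator A i) =
       (\<Sum>A\<in>compatible \<S> Y. indicator B Y * posterior_prob \<S> Y i)" for Y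
    proof (cases "compatible \<S> Y = {}")
      case False
      hence "real (card (compatible \<S> Y)) \<noteq> 0" using finite_compatible by simp
      thus ?thesis
        by (simp add: sum_distrib_left[symmetric] sum_indicator_compatible posterior_prob_def)
    qed simp
    have "(\<integral>\<omega>\<in>E. signal i \<omega> \<partial>?M) = measure_pmf.expectation (planted N \<S> p)
       (\<lambda>\<omega>. (\<lambda>A Y. indicator B Y * indicator A i) (fst \<omega>) (observation \<omega>))"
      by (auto simp: set_lebesgue_integral_def E signal_def indicator_def split: prod.splits
               intro!: Bochner_Integration.integral_cong)
    also have "\<dots> = measure_pmf.expectation (planted N \<S> p)
       (\<lambda>\<omega>. (\<lambda>A Y. indicator B Y * posterior_prob \<S> Y i) (fst \<omega>) (observation \<omega>))"
      using expectation_planted[OF p, of "\<lambda>A Y. indicator B Y * indicator A i"]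
        expectation_planted[OF p, of "\<lambda>A Y. indicator B Y * posterior_prob \<S> Y i"]
      by (simp only: eqP)
    also have "\<dots> = (\<integral>\<omega>\<in>E. posterior_prob \<S> (observation \<omega>) i \<partial>?M)"
      by (auto simp: set_lebesgue_integral_def E indicator_def
               intro!: Bochner_Integration.integral_cong)
    finally show "(\<integral>\<omega>\<in>E. signal i \<omega> \<partial>?M) = (\<integral>\<omega>\<in>E. posterior_prob \<S> (observation \<omega>) i \<partial>?M)" .
  next
    show "(\<lambda>\<omega>. posterior_prob \<S> (observation \<omega>) i) \<in> borel_measurable ?F"
      by (rule measurable_compose[OF meas]) simp
  qed (simp_all add: integrable_measure_pmf_finite finite_set_pmf_planted)
qed

lemma sum_posterior_variance:
  "(\<Sum>A\<in>compatible \<S> Y. (indicator A i - posterior_prob \<S> Y i)\<^sup>2) =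
   real (card (compatible \<S> Y)) * (posterior_prob \<S> Y i * (1 - posterior_prob \<S> Y i))"
proof (cases "compatible \<S> Y = {}")
  case False
  define m where "m = posterior_prob \<S> Y i"
  define Z where "Z = real (card (compatible \<S> Y))"
  have Z: "Z \<noteq> 0" using False finite_compatible by (simp add: Z_def)
  have n: "(\<Sum>A\<in>compatible \<S> Y. indicator A i) = Z * m"
    using Z by (simp add: sum_indicator_compatible m_def posterior_prob_def Z_def)
  have "(\<Sum>A\<in>compatible \<S> Y. (indicator A i - m)\<^sup>2) =
        (\<Sum>A\<in>compatible \<S> Y. (1 - 2 * m) * indicator A i + m\<^sup>2)"
    by (intro sum.cong refl) (auto simp: indicator_def power2_eq_square algebra_simps)
  also have "\<dots> = (1 - 2 * m) * (Z * m) + Z * m\<^sup>2"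
    by (simp add: sum.distrib sum_distrib_left[symmetric] n Z_def)
  finally show ?thesis by (simp add: m_def Z_def power2_eq_square algebra_simps)
qed simp

lemma MMSE_eq_posterior_variance:
  assumes p: "p \<in> {0..1}"
  shows "MMSE N \<S> p = (\<Sum>Y\<in>Pow {1..N}. likelihood N K p Y *
     (\<Sum>i\<in>{1..N}. real (card (compatible \<S> Y)) * (posterior_prob \<S> Y i * (1 - posterior_prob \<S> Y i))))
     / real (card \<S>)"
proof -
  have "AE \<omega> in measure_pmf (planted N \<S> p). \<forall>i\<in>{1..N}.
           posterior_mean N \<S> p i \<omega> = posterior_prob \<S> (observation \<omega>) i"
    using posterior_mean_eq[OF p] by (intro AE_finite_allI) auto
  hence "MMSE N \<S> p = measure_pmf.expectation (planted N \<S> p)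
    (\<lambda>\<omega>. (\<lambda>A Y. \<Sum>i\<in>{1..N}. (indicator A i - posterior_prob \<S> Y i)\<^sup>2) (fst \<omega>) (observation \<omega>))"
    unfolding MMSE_def
    by (intro integral_cong_AE)
       (auto simp: L2_set_def sum_nonneg signal_def split: prod.splits elim!: eventually_mono intro!: sum.cong)
  also have "\<dots> = (\<Sum>Y\<in>Pow {1..N}. likelihood N K p Y *
     (\<Sum>A\<in>compatible \<S> Y. \<Sum>i\<in>{1..N}. (indicator A i - posterior_prob \<S> Y i)\<^sup>2)) / real (card \<S>)"
    by (rule expectation_planted[OF p])
  also have "\<dots> = (\<Sum>Y\<in>Pow {1..N}. likelihood N K p Y *
     (\<Sum>i\<in>{1..N}. \<Sum>A\<in>compatible \<S> Y. (indicator A i - posterior_prob \<S> Y i)\<^sup>2)) / real (card \<S>)"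
    by (subst sum.swap) (rule refl)
  finally show ?thesis by (simp only: sum_posterior_variance)
qed

section \<open>Growth of the conditional entropy\<close>

lemma sum_likelihood_above:
  "A \<in> \<S> \<Longrightarrow> (\<Sum>Y | A \<subseteq> Y \<and> Y \<subseteq> {1..N}. likelihood N K p Y) = 1"
  using sum_over_noise[of A p "\<lambda>_. 1"] by (simp add: sum_Pow_binomial_weights)

lemma sum_likelihood_compatible:
  "(\<Sum>Y\<in>Pow {1..N}. likelihood N K p Y * (\<Sum>A\<in>compatible \<S> Y. g A)) = (\<Sum>A\<in>\<S>. g A)"
proof -
  have "(\<Sum>Y\<in>Pow {1..N}. likelihood N K p Y * (\<Sum>A\<in>compatible \<S> Y. g A)) =
        (\<Sum>A\<in>\<S>. \<Sum>Y | A \<subseteq> Y \<and> Y \<subseteq> {1..N}. likelihood N K p Y * g A)"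
    by (simp add: sum_compatible_swap sum_distrib_left del: One_nat_def)
  also have "\<dots> = (\<Sum>A\<in>\<S>. g A)"
  proof (intro sum.cong refl)
    fix A assume "A \<in> \<S>"
    thus "(\<Sum>Y | A \<subseteq> Y \<and> Y \<subseteq> {1..N}. likelihood N K p Y * g A) = g A"
      using sum_distrib_right[of "likelihood N K p" "{Y. A \<subseteq> Y \<and> Y \<subseteq> {1..N}}" "g A"]
      by (metis sum_likelihood_above mult_1)
  qed
  finally show ?thesis .
qed

lemma sum_likelihood_card:
  "(\<Sum>Y\<in>Pow {1..N}. likelihood N K p Y * real (card (compatible \<S> Y))) = real (card \<S>)"
  using sum_likelihood_compatible[of p "\<lambda>_. 1"] by simp

lemma card_le_of_compatible:
  assumes "compatible \<S> Y \<noteq> {}" "finite Y"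
  shows "K \<le> card Y"
  using assms by (auto simp: compatible_def card_eq[symmetric] intro: card_mono)

lemma conditional_entropy_nonneg:
  assumes "p \<in> {0..1}"
  shows "0 \<le> conditional_entropy N K \<S> p"
proof -
  have "0 \<le> real n * ln (real n)" for n :: nat by (cases n) simp_all
  hence "0 \<le> likelihood N K p Y * (real (card (compatible \<S> Y)) * ln (real (card (compatible \<S> Y))))" for Y
    by (intro mult_nonneg_nonneg[OF likelihood_nonneg[OF assms]])
  thus ?thesis unfolding conditional_entropy_def
    by (intro divide_nonneg_nonneg sum_nonneg) auto
qed

text \<open>At \<open>p = 1\<close> the observation is all of \<open>{1..N}\<close> and carries no information.\<close>

lemma conditional_entropy_1: "conditional_entropy N K \<S> 1 = ln (real (card \<S>))"
proof -
  let ?\<phi> = "\<lambda>Y. real (card (compatible \<S> Y)) * ln (real (card (compatible \<S> Y)))"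
  have lik: "likelihood N K 1 Y = (if Y = {1..N} then 1 else 0)" if "Y \<in> Pow {1..N}" for Y
  proof (cases "Y = {1..N}")
    case False
    hence "Y \<subset> {1..N}" using that by auto
    hence "card Y < N" using psubset_card_mono[of "{1..N}" Y] by simp
    thus ?thesis using False by (simp add: likelihood_def)
  qed (simp add: likelihood_def)
  have "(\<Sum>Y\<in>Pow {1..N}. likelihood N K 1 Y * ?\<phi> Y) =
        (\<Sum>Y\<in>Pow {1..N}. if Y = {1..N} then ?\<phi> {1..N} else 0)"
    by (intro sum.cong refl) (simp add: lik)
  also have "\<dots> = ?\<phi> {1..N}" by (simp add: sum.delta')
  also have "compatible \<S> {1..N} = \<S>" using subset by (auto simp: compatible_def)
  finally show ?thesis using card_prior_pos by (simp add: conditional_entropy_def)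
qed

lemma sum_card_containing:
  assumes "finite Y" "\<And>A. A \<in> C \<Longrightarrow> A \<subseteq> Y" "C \<subseteq> \<S>"
  shows "(\<Sum>i\<in>Y. real (card {A \<in> C. i \<in> A})) = real K * real (card C)"
proof -
  have finC: "finite C" using assms(3) finite_prior finite_subset by blast
  have "(\<Sum>i\<in>Y. real (card {A \<in> C. i \<in> A})) = (\<Sum>i\<in>Y. \<Sum>A\<in>{A \<in> C. i \<in> A}. 1)"
    by simp
  also have "\<dots> = (\<Sum>A\<in>C. \<Sum>i\<in>{i \<in> Y. i \<in> A}. 1)"
    using assms(1) finC by (rule sum.swap_restrict)
  also have "\<dots> = (\<Sum>A\<in>C. real K)"
  proof (intro sum.cong refl)
    fix A assume A: "A \<in> C"
    hence "{i \<in> Y. i \<in> A} = A" using assms(2) by auto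
    thus "(\<Sum>i\<in>{i \<in> Y. i \<in> A}. 1) = real K" using A assms(3) card_eq by auto
  qed
  finally show ?thesis by simp
qed

text \<open>Write \<open>m\<^sub>i\<close> for the posterior probability of \<open>i\<close>, and \<open>Z\<close> for the number of compatible signals.
  Removing \<open>i\<close> from \<open>Y\<close> leaves \<open>Z * (1 - m\<^sub>i)\<close> of them, and these counts add up to
  \<open>Z * (card Y - K)\<close>. Therefore the right-hand side equals \<open>Z\<close> times the sum of
  \<open>- (1 - m\<^sub>i) * ln (1 - m\<^sub>i)\<close>, and \<open>- ln (1 - m) \<ge> m\<close> gives the variance.\<close>

lemma posterior_variance_le_entropy_drop:
  assumes Y: "Y \<subseteq> {1..N}"
  defines "\<phi> \<equiv> \<lambda>Y. real (card (compatible \<S> Y)) * ln (real (card (compatible \<S> Y)))"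
  shows "(\<Sum>i\<in>{1..N}. real (card (compatible \<S> Y)) * (posterior_prob \<S> Y i * (1 - posterior_prob \<S> Y i)))
         \<le> real (card Y - K) * \<phi> Y - (\<Sum>i\<in>Y. \<phi> (Y - {i}))"
proof (cases "compatible \<S> Y = {}")
  case True
  hence "compatible \<S> (Y - {i}) = {}" for i by (auto simp: compatible_def)
  thus ?thesis using True by (simp add: \<phi>_def)
next
  case False
  have finY: "finite Y" using Y finite_subset by blast
  define Z where "Z = real (card (compatible \<S> Y))"
  define n where "n = (\<lambda>i. real (card {A \<in> compatible \<S> Y. i \<in> A}))"
  define W where "W = (\<lambda>i. real (card (compatible \<S> (Y - {i}))))"
  have Z: "Z > 0" using False finite_compatible by (simp add: Z_def card_gt_0_iff)
  have m: "posterior_prob \<S> Y i = n i / Z" for i by (simp add: posterior_prob_def n_def Z_def)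
  have W: "W i = Z - n i" for i
  proof -
    have "compatible \<S> Y = compatible \<S> (Y - {i}) \<union> {A \<in> compatible \<S> Y. i \<in> A}"
      by (auto simp: compatible_def)
    also have "card \<dots> = card (compatible \<S> (Y - {i})) + card {A \<in> compatible \<S> Y. i \<in> A}"
      using finite_prior by (intro card_Un_disjoint) (auto simp: compatible_def)
    finally show ?thesis by (simp add: W_def Z_def n_def)
  qed
  have "(\<Sum>i\<in>Y. n i) = real K * Z"
    unfolding n_def Z_def by (rule sum_card_containing) (use finY in \<open>auto simp: compatible_def\<close>)
  hence sumW: "(\<Sum>i\<in>Y. W i) = real (card Y - K) * Z"
    using card_le_of_compatible[OF False finY] by (simp add: W sum_subtractf of_nat_diff algebra_simps)
  have n0: "n i = 0" if "i \<notin> Y" for i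
  proof -
    have none: "{A \<in> compatible \<S> Y. i \<in> A} = {}" using that by (auto simp: compatible_def)
    show ?thesis unfolding n_def none by simp
  qed
  have "(\<Sum>i\<in>{1..N}. Z * (posterior_prob \<S> Y i * (1 - posterior_prob \<S> Y i))) =
        (\<Sum>i\<in>Y. Z * (n i / Z * (1 - n i / Z)))"
    unfolding m by (rule sum.mono_neutral_right) (use Y n0 in auto)
  also have "\<dots> \<le> (\<Sum>i\<in>Y. W i * ln Z - W i * ln (W i))"
  proof (rule sum_mono)
    fix i
    show "Z * (n i / Z * (1 - n i / Z)) \<le> W i * ln Z - W i * ln (W i)"
    proof (cases "W i = 0")
      case True
      hence "n i = Z" using W[of i] by simp
      thus ?thesis using Z True by simp
    next
      case False
      hence pos: "W i > 0" by (simp add: W_def)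
      have "ln (W i / Z) \<le> W i / Z - 1" using pos Z by (intro ln_le_minus_one) simp
      hence "1 - W i / Z \<le> ln Z - ln (W i)" using pos Z by (simp add: ln_div)
      hence "W i * (1 - W i / Z) \<le> W i * (ln Z - ln (W i))" using pos by (intro mult_left_mono) auto
      moreover have "Z * (n i / Z * (1 - n i / Z)) = W i * (1 - W i / Z)"
        using Z by (simp add: W field_simps)
      ultimately show ?thesis by (simp add: algebra_simps)
    qed
  qed
  also have "\<dots> = real (card Y - K) * (Z * ln Z) - (\<Sum>i\<in>Y. W i * ln (W i))"
    by (simp add: sum_subtractf sum_distrib_right[symmetric] sumW)
  finally show ?thesis by (simp add: \<phi>_def Z_def W_def)
qed

text \<open>This is the analogue of the I-MMSE relation: on the scale of \<open>ln p\<close> the conditional entropy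
  increases at a rate that is at least the minimum mean square error. The derivative of the weight
  of \<open>Y\<close> splits into a term for each noise point of \<open>Y\<close> and a term for each point outside \<open>Y\<close>. After
  the latter are reindexed by the set \<open>insert i Y\<close>, the two combine into the entropy drop bounded
  above.\<close>

lemma conditional_entropy_derivative:
  assumes p: "0 < p" "p < 1"
  shows "\<exists>d. (conditional_entropy N K \<S> has_real_derivative d) (at p) \<and> MMSE N \<S> p \<le> p * d"
proof -
  define \<phi> where "\<phi> = (\<lambda>Y :: nat set. real (card (compatible \<S> Y)) * ln (real (card (compatible \<S> Y))))"
  define dl where "dl = (\<lambda>Y :: nat set. real (card Y - K) * p ^ (card Y - K - 1) * (1 - p) ^ (N - card Y) -
      p ^ (card Y - K) * (real (N - card Y) * (1 - p) ^ (N - card Y - 1)))"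
  define d where "d = (\<Sum>Y\<in>Pow {1..N}. dl Y * \<phi> Y) / real (card \<S>)"
  have lik: "((\<lambda>p. likelihood N K p Y) has_real_derivative dl Y) (at p)" for Y
    unfolding likelihood_def dl_def by (auto intro!: derivative_eq_intros simp: algebra_simps)
  have deriv: "(conditional_entropy N K \<S> has_real_derivative d) (at p)"
    unfolding conditional_entropy_def[abs_def] d_def \<phi>_def
    by (intro DERIV_cdivide DERIV_sum DERIV_cmult_right lik)
  have up: "p * (real (card Y - K) * p ^ (card Y - K - 1)) = real (card Y - K) * p ^ (card Y - K)" for Y :: "nat set"
    by (cases "card Y - K") auto
  have "p * (\<Sum>Y\<in>Pow {1..N}. dl Y * \<phi> Y) =
      (\<Sum>Y\<in>Pow {1..N}. real (card Y - K) * likelihood N K p Y * \<phi> Y) -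
      (\<Sum>Y\<in>Pow {1..N}. real (N - card Y) * (p ^ Suc (card Y - K) * (1 - p) ^ (N - card Y - 1) * \<phi> Y))"
  proof -
    have "p * (dl Y * \<phi> Y) = real (card Y - K) * likelihood N K p Y * \<phi> Y -
       real (N - card Y) * (p ^ Suc (card Y - K) * (1 - p) ^ (N - card Y - 1) * \<phi> Y)" for Y
    proof -
      have "p * (dl Y * \<phi> Y) =
        (p * (real (card Y - K) * p ^ (card Y - K - 1))) * ((1 - p) ^ (N - card Y) * \<phi> Y) -
        real (N - card Y) * (p ^ Suc (card Y - K) * (1 - p) ^ (N - card Y - 1) * \<phi> Y)"
        unfolding dl_def by (simp add: algebra_simps)
      thus ?thesis unfolding up by (simp add: likelihood_def mult_ac)
    qed
    thus ?thesis by (simp add: sum_distrib_left sum_subtractf)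
  qed
  also have "(\<Sum>Y\<in>Pow {1..N}. real (N - card Y) * (p ^ Suc (card Y - K) * (1 - p) ^ (N - card Y - 1) * \<phi> Y)) =
      (\<Sum>Y\<in>Pow {1..N}. \<Sum>i\<in>{1..N} - Y. p ^ Suc (card Y - K) * (1 - p) ^ (N - card Y - 1) * \<phi> Y)"
  proof (intro sum.cong refl)
    fix Y assume "Y \<in> Pow {1..N}"
    hence "card ({1..N} - Y) = N - card Y" by (subst card_Diff_subset) (auto intro: finite_subset)
    thus "real (N - card Y) * (p ^ Suc (card Y - K) * (1 - p) ^ (N - card Y - 1) * \<phi> Y) =
      (\<Sum>i\<in>{1..N} - Y. p ^ Suc (card Y - K) * (1 - p) ^ (N - card Y - 1) * \<phi> Y)" by simp
  qed
  also have "\<dots> = (\<Sum>Y\<in>Pow {1..N}. \<Sum>i\<in>Y.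
      p ^ Suc (card (Y - {i}) - K) * (1 - p) ^ (N - card (Y - {i}) - 1) * \<phi> (Y - {i}))"
    by (rule sum_Pow_remove_element) simp
  also have "\<dots> = (\<Sum>Y\<in>Pow {1..N}. \<Sum>i\<in>Y. likelihood N K p Y * \<phi> (Y - {i}))"
  proof (intro sum.cong refl)
    fix Y i assume Y: "Y \<in> Pow {1..N}" and i: "i \<in> Y"
    have finY: "finite Y" using Y finite_subset by blast
    have cY: "card Y = Suc (card (Y - {i}))" using finY i by (rule card.remove)
    show "p ^ Suc (card (Y - {i}) - K) * (1 - p) ^ (N - card (Y - {i}) - 1) * \<phi> (Y - {i}) =
          likelihood N K p Y * \<phi> (Y - {i})"
    proof (cases "compatible \<S> (Y - {i}) = {}")
      case False
      hence "K \<le> card (Y - {i})" using card_le_of_compatible finY by blast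
      thus ?thesis by (simp add: likelihood_def cY Suc_diff_le)
    qed (simp add: \<phi>_def)
  qed
  also have "(\<Sum>Y\<in>Pow {1..N}. real (card Y - K) * likelihood N K p Y * \<phi> Y) -
      (\<Sum>Y\<in>Pow {1..N}. \<Sum>i\<in>Y. likelihood N K p Y * \<phi> (Y - {i})) =
      (\<Sum>Y\<in>Pow {1..N}. likelihood N K p Y * (real (card Y - K) * \<phi> Y - (\<Sum>i\<in>Y. \<phi> (Y - {i}))))"
    by (simp add: sum_subtractf sum_distrib_left right_diff_distrib mult_ac)
  finally have eq: "p * (\<Sum>Y\<in>Pow {1..N}. dl Y * \<phi> Y) = \<dots>" .
  have "MMSE N \<S> p = (\<Sum>Y\<in>Pow {1..N}. likelihood N K p Y *
     (\<Sum>i\<in>{1..N}. real (card (compatible \<S> Y)) * (posterior_prob \<S> Y i * (1 - posterior_prob \<S> Y i))))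
     / real (card \<S>)"
    using p by (intro MMSE_eq_posterior_variance) simp
  also have "\<dots> \<le> p * (\<Sum>Y\<in>Pow {1..N}. dl Y * \<phi> Y) / real (card \<S>)"
    unfolding eq using p
    by (intro divide_right_mono sum_mono mult_left_mono likelihood_nonneg)
       (auto simp: \<phi>_def simp del: One_nat_def intro!: posterior_variance_le_entropy_drop)
  finally show ?thesis using deriv by (auto simp: d_def)
qed

lemma continuous_on_conditional_entropy: "continuous_on X (conditional_entropy N K \<S>)"
  unfolding conditional_entropy_def[abs_def] likelihood_def divide_inverse
  by (intro continuous_intros)

text \<open>Integrate the derivative bound from \<open>q\<close> to \<open>1\<close>: the conditional entropy is nonnegative at \<open>q\<close>, ends
  at \<open>ln (card \<S>)\<close>, and its slope in \<open>ln p\<close> is at least \<open>c\<close>.\<close>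

lemma log_card_ge_of_MMSE_ge:
  assumes q: "0 < q" "q \<le> 1"
    and MMSE: "\<And>p. q < p \<Longrightarrow> p < 1 \<Longrightarrow> c \<le> MMSE N \<S> p"
  shows "c * (- ln q) \<le> ln (real (card \<S>))"
proof -
  \<comment> \<open>The derivative in \<open>p\<close> of the entropy is at least \<open>MMSE / p\<close>, so this function increases on
    \<open>(q, 1)\<close>.\<close>
  define g where "g = (\<lambda>p. conditional_entropy N K \<S> p - c * ln p)"
  have "g q \<le> g 1"
  proof (rule DERIV_nonneg_imp_increasing_open[where f = g])
    fix p assume p: "q < p" "p < 1"
    then obtain d where d: "(conditional_entropy N K \<S> has_real_derivative d) (at p)" "MMSE N \<S> p \<le> p * d"
      using conditional_entropy_derivative[of p] q by auto
    have "(g has_real_derivative (d - c * (1 / p))) (at p)"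
      unfolding g_def using p q by (intro DERIV_diff d(1) DERIV_cmult DERIV_ln_divide) auto
    moreover have "c \<le> p * d" using MMSE[OF p] d(2) by simp
    hence "0 \<le> d - c * (1 / p)" using p q by (simp add: field_simps)
    ultimately show "\<exists>y. (g has_real_derivative y) (at p) \<and> 0 \<le> y" by blast
  next
    show "continuous_on {q..1} g"
      unfolding g_def using q by (intro continuous_intros continuous_on_conditional_entropy) auto
  qed (use q in auto)
  moreover have "0 \<le> conditional_entropy N K \<S> q" using q by (intro conditional_entropy_nonneg) simp
  ultimately show ?thesis by (simp add: g_def conditional_entropy_1)
qed

section \<open>Information bound and weak separation\<close>

text \<open>The difference of the two sides is the relative entropy between the law of \<open>Y\<close> and the law of pure
  noise \<open>V\<close>: their density ratio at \<open>Y\<close> is \<open>Z / (card \<S> * p ^ K)\<close>, where \<open>Z\<close> is the number of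
  compatible signals. It is nonnegative by \<open>ln x \<ge> 1 - 1 / x\<close>.\<close>

lemma conditional_entropy_ge:
  assumes p: "0 < p" "p \<le> 1"
  shows "ln (real (card \<S>)) + real K * ln p \<le> conditional_entropy N K \<S> p"
proof -
  define M where "M = real (card \<S>)"
  have M: "M > 0" using card_prior_pos by (simp add: M_def)
  define L where "L = ln M + real K * ln p"
  have pointwise: "likelihood N K p Y * real (card (compatible \<S> Y)) * (L + 1)
        - M * (p ^ card Y * (1 - p) ^ card ({1..N} - Y))
      \<le> likelihood N K p Y * (real (card (compatible \<S> Y)) * ln (real (card (compatible \<S> Y))))"
    if Y: "Y \<in> Pow {1..N}" for Y
  proof (cases "compatible \<S> Y = {}")
    case True
    thus ?thesis using M p by simp
  next
    case False
    have finY: "finite Y" using Y finite_subset by blast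
    define Z where "Z = real (card (compatible \<S> Y))"
    have Z: "Z > 0" using False finite_compatible by (simp add: Z_def card_gt_0_iff)
    have "ln (M * p ^ K / Z) \<le> M * p ^ K / Z - 1" using M p Z by (intro ln_le_minus_one) simp
    hence "L + 1 - M * p ^ K / Z \<le> ln Z" using M p Z by (simp add: L_def ln_div ln_mult ln_realpow)
    hence "likelihood N K p Y * Z * (L + 1 - M * p ^ K / Z) \<le> likelihood N K p Y * Z * ln Z"
      using Z p likelihood_nonneg by (intro mult_left_mono) auto
    moreover have "likelihood N K p Y * p ^ K = p ^ card Y * (1 - p) ^ card ({1..N} - Y)"
    proof -
      have "card ({1..N} - Y) = N - card Y" using Y finY by (subst card_Diff_subset) auto
      moreover have "p ^ (card Y - K) * p ^ K = p ^ card Y"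
        using card_le_of_compatible[OF False finY] by (simp flip: power_add)
      ultimately show ?thesis by (simp add: likelihood_def)
    qed
    hence "likelihood N K p Y * Z * (L + 1 - M * p ^ K / Z) =
       likelihood N K p Y * Z * (L + 1) - M * (p ^ card Y * (1 - p) ^ card ({1..N} - Y))"
      using Z by (simp add: field_simps)
    ultimately show ?thesis by (simp add: Z_def mult_ac)
  qed
  have "M * L = (\<Sum>Y\<in>Pow {1..N}. likelihood N K p Y * real (card (compatible \<S> Y)) * (L + 1)
        - M * (p ^ card Y * (1 - p) ^ card ({1..N} - Y)))"
    unfolding sum_subtractf sum_distrib_right[symmetric] sum_distrib_left[symmetric]
      sum_likelihood_card sum_Pow_binomial_weights[OF finite_atLeastAtMost]
    by (simp add: M_def algebra_simps)
  also have "\<dots> \<le> M * conditional_entropy N K \<S> p"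
    using M by (simp add: conditional_entropy_def M_def[symmetric] del: One_nat_def) (intro sum_mono pointwise)
  finally show ?thesis using M by (simp add: L_def M_def)
qed

text \<open>The expected number of points of the true signal \<open>A\<close> missed by an independent sample from the
  posterior.\<close>

definition posterior_defect :: "nat set \<Rightarrow> nat set \<Rightarrow> real" where
  "posterior_defect Y A = real K -
     (\<Sum>B\<in>compatible \<S> Y. real (card (A \<inter> B))) / real (card (compatible \<S> Y))"

text \<open>A posterior sample \<open>B\<close> and the true signal \<open>A\<close> are exchangeable given \<open>Y\<close>, so the sum of the squares
  \<open>m\<^sub>i\<^sup>2\<close> of the posterior probabilities is the mean size of \<open>A \<inter> B\<close>.\<close>

lemma posterior_variance_eq_defect:
  "(\<Sum>i\<in>{1..N}. real (card (compatible \<S> Y)) * (posterior_prob \<S> Y i * (1 - posterior_prob \<S> Y i))) =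
   (\<Sum>A\<in>compatible \<S> Y. posterior_defect Y A)"
proof (cases "compatible \<S> Y = {}")
  case False
  define C where "C = compatible \<S> Y"
  define Z where "Z = real (card C)"
  define n where "n = (\<lambda>i. real (card {A \<in> C. i \<in> A}))"
  have finC: "finite C" by (simp add: C_def finite_compatible)
  have Z: "Z > 0" using False finC by (simp add: Z_def C_def card_gt_0_iff)
  have mem: "A \<in> C \<Longrightarrow> A \<in> \<S>" for A by (simp add: C_def compatible_def)
  have sum_n: "(\<Sum>i\<in>{1..N}. n i) = real K * Z"
    unfolding n_def Z_def by (rule sum_card_containing) (use mem subset in auto)
  have n: "n i = (\<Sum>A\<in>C. indicator A i)" for i
    by (simp add: n_def C_def sum_indicator_compatible)
  have card_Int: "(\<Sum>i\<in>{1..N}. indicator A i * indicator B i) = real (card (A \<inter> B))" if "A \<in> C" for A B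
  proof -
    have "{1..N} \<inter> (A \<inter> B) = A \<inter> B" using subset mem that by blast
    hence "real (card (A \<inter> B)) = (\<Sum>i\<in>{1..N} \<inter> (A \<inter> B). 1)" by simp
    also have "\<dots> = (\<Sum>i\<in>{1..N}. if i \<in> A \<inter> B then 1 else 0)"
      by (rule sum.inter_restrict) simp
    also have "\<dots> = (\<Sum>i\<in>{1..N}. indicator A i * indicator B i)"
      by (intro sum.cong) (auto simp: indicator_def)
    finally show ?thesis ..
  qed
  have "(\<Sum>i\<in>{1..N}. (n i)\<^sup>2) = (\<Sum>i\<in>{1..N}. \<Sum>A\<in>C. \<Sum>B\<in>C. indicator A i * indicator B i)"
    by (simp add: n power2_eq_square sum_product)
  also have "\<dots> = (\<Sum>A\<in>C. \<Sum>i\<in>{1..N}. \<Sum>B\<in>C. indicator A i * indicator B i)"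
    by (rule sum.swap)
  also have "\<dots> = (\<Sum>A\<in>C. \<Sum>B\<in>C. \<Sum>i\<in>{1..N}. indicator A i * indicator B i)"
    by (intro sum.cong refl sum.swap)
  also have "\<dots> = (\<Sum>A\<in>C. \<Sum>B\<in>C. real (card (A \<inter> B)))"
    by (intro sum.cong refl card_Int)
  finally have sum_sq: "(\<Sum>i\<in>{1..N}. (n i)\<^sup>2) = (\<Sum>A\<in>C. \<Sum>B\<in>C. real (card (A \<inter> B)))" .
  have "(\<Sum>i\<in>{1..N}. Z * (n i / Z * (1 - n i / Z))) = (\<Sum>i\<in>{1..N}. n i - (n i)\<^sup>2 / Z)"
    using Z by (intro sum.cong refl) (simp add: field_simps power2_eq_square)
  also have "\<dots> = real K * Z - (\<Sum>A\<in>C. \<Sum>B\<in>C. real (card (A \<inter> B))) / Z"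
    by (simp only: sum_subtractf sum_n sum_divide_distrib[symmetric] sum_sq)
  also have "\<dots> = (\<Sum>A\<in>C. real K - (\<Sum>B\<in>C. real (card (A \<inter> B))) / Z)"
    by (simp add: sum_subtractf sum_divide_distrib Z_def)
  finally show ?thesis
    by (simp add: posterior_defect_def posterior_prob_def n_def Z_def C_def)
qed simp

definition near :: "real \<Rightarrow> nat set \<Rightarrow> nat set set" where
  "near \<delta> A = {B \<in> \<S>. real (card (A \<inter> B)) \<ge> (1 - \<delta>) * real K}"

lemma finite_near: "finite (near \<delta> A)"
  using finite_prior by (simp add: near_def)

lemma near_self: "0 \<le> \<delta> \<Longrightarrow> A \<in> \<S> \<Longrightarrow> A \<in> near \<delta> A"
  by (simp add: near_def card_eq algebra_simps)

lemma overlap_prob_eq: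
  "overlap_prob K \<S> \<delta> * real (card \<S>) = (\<Sum>A\<in>\<S>. real (card (near \<delta> A))) / real (card \<S>)"
proof -
  let ?E = "{(A, B). real (card (A \<inter> B)) \<ge> (1 - \<delta>) * real K}"
  let ?P = "pair_pmf (pmf_of_set \<S>) (pmf_of_set \<S>)"
  have "set_pmf ?P = \<S> \<times> \<S>" using nonempty finite_prior by simp
  hence "overlap_prob K \<S> \<delta> = measure_pmf.prob ?P (\<S> \<times> \<S> \<inter> ?E)"
    unfolding overlap_prob_def using measure_Int_set_pmf[of ?P ?E] by (simp add: Int_commute)
  also have "\<dots> = (\<Sum>x\<in>\<S> \<times> \<S> \<inter> ?E. pmf ?P x)"
    using finite_prior by (intro measure_measure_pmf_finite) auto
  also have "\<dots> = (\<Sum>x\<in>\<S> \<times> \<S> \<inter> ?E. 1 / real (card (\<S> \<times> \<S>)))"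
    by (intro sum.cong refl)
       (auto simp: pmf_pair pmf_of_set[OF nonempty finite_prior] card_cartesian_product)
  also have "\<dots> = real (card (\<S> \<times> \<S> \<inter> ?E)) / real (card (\<S> \<times> \<S>))" by simp
  also have "\<S> \<times> \<S> \<inter> ?E = (SIGMA A:\<S>. near \<delta> A)" by (auto simp: near_def)
  also have "real (card \<dots>) = (\<Sum>A\<in>\<S>. real (card (near \<delta> A)))"
    using finite_prior finite_near by (subst card_SigmaI) auto
  finally show ?thesis using card_prior_pos by (simp add: card_cartesian_product)
qed

text \<open>A small posterior defect forces, by Markov's inequality, all but a fraction \<open>\<gamma>\<close> of the compatible
  signals to be near \<open>A\<close>. A large one, above \<open>\<gamma> * \<delta> * K\<close>, is paid for by the last term and the
  trivial bound \<open>card \<S>\<close>.\<close>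

lemma log_card_compatible_le:
  assumes A: "A \<in> compatible \<S> Y" and \<delta>: "0 < \<delta>" and \<gamma>: "0 < \<gamma>" "\<gamma> < 1"
  shows "ln (real (card (compatible \<S> Y))) \<le> ln (real (card (near \<delta> A))) - ln (1 - \<gamma>)
           + posterior_defect Y A / (\<gamma> * \<delta> * real K) * ln (real (card \<S>))"
proof -
  define C where "C = compatible \<S> Y"
  define Z where "Z = real (card C)"
  define W where "W = real (card (near \<delta> A))"
  define r where "r = posterior_defect Y A"
  have finC: "finite C" by (simp add: C_def finite_compatible)
  have AS: "A \<in> \<S>" using A by (simp add: compatible_def)
  have "A \<in> C" using A by (simp add: C_def)
  hence Z: "Z \<ge> 1" using finC by (simp add: Z_def card_gt_0_iff Suc_le_eq) auto
  have "card (near \<delta> A) > 0" using near_self[OF _ AS, of \<delta>] \<delta> finite_near by (auto simp: card_gt_0_iff)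
  hence W: "W \<ge> 1" by (simp add: W_def)
  have K: "real K > 0" using K_pos by simp
  have ZM: "Z \<le> real (card \<S>)" using compatible_le_prior by (simp add: Z_def C_def)
  have "(\<Sum>B\<in>C. real (card (A \<inter> B))) \<le> (\<Sum>B\<in>C. (1 - \<delta>) * real K + \<delta> * real K * indicator (near \<delta> A) B)"
  proof (rule sum_mono)
    fix B assume B: "B \<in> C"
    have "real (card (A \<inter> B)) \<le> real K"
      using finite_member[OF AS] card_eq[OF AS] card_mono[of A "A \<inter> B"] by simp
    thus "real (card (A \<inter> B)) \<le> (1 - \<delta>) * real K + \<delta> * real K * indicator (near \<delta> A) B"
      using B by (auto simp: near_def indicator_def C_def compatible_def algebra_simps)
  qed
  also have "\<dots> = Z * ((1 - \<delta>) * real K) + \<delta> * real K * real (card (C \<inter> near \<delta> A))"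
    using finC by (simp add: sum.distrib sum_distrib_left[symmetric] Z_def indicator_def sum.If_cases)
  also have "\<dots> \<le> Z * ((1 - \<delta>) * real K) + \<delta> * real K * W"
    unfolding W_def using \<delta> finite_near
    by (intro add_left_mono mult_left_mono of_nat_mono card_mono) auto
  finally have "(\<Sum>B\<in>C. real (card (A \<inter> B))) / Z \<le> (1 - \<delta>) * real K + \<delta> * real K * W / Z"
    using Z by (simp add: field_simps)
  hence r_ge: "\<delta> * real K * (1 - W / Z) \<le> r"
    by (simp add: r_def posterior_defect_def C_def Z_def algebra_simps)
  have "(\<Sum>B\<in>C. real (card (A \<inter> B))) \<le> (\<Sum>B\<in>C. real K)"
    using finite_member[OF AS] card_eq[OF AS] card_mono[of A "A \<inter> _"] by (intro sum_mono) simp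
  hence r_nonneg: "0 \<le> r"
    using Z by (simp add: r_def posterior_defect_def C_def Z_def field_simps)
  have "ln Z \<le> ln W - ln (1 - \<gamma>) + r / (\<gamma> * \<delta> * real K) * ln (real (card \<S>))"
  proof (cases "r \<le> \<gamma> * \<delta> * real K")
    case True
    hence "\<delta> * real K * (1 - W / Z) \<le> \<delta> * real K * \<gamma>" using r_ge by (simp add: mult_ac)
    hence "1 - W / Z \<le> \<gamma>" using \<delta> K by simp
    hence "Z * (1 - \<gamma>) \<le> W" using Z by (simp add: field_simps)
    hence "ln (Z * (1 - \<gamma>)) \<le> ln W" using Z \<gamma> W by (subst ln_le_cancel_iff) auto
    hence "ln Z \<le> ln W - ln (1 - \<gamma>)" using Z \<gamma> by (simp add: ln_mult)
    moreover have "0 \<le> r / (\<gamma> * \<delta> * real K) * ln (real (card \<S>))"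
      using r_nonneg \<gamma> \<delta> K Z ZM by (intro mult_nonneg_nonneg divide_nonneg_nonneg) auto
    ultimately show ?thesis by simp
  next
    case False
    hence "1 \<le> r / (\<gamma> * \<delta> * real K)" using \<gamma> \<delta> K by simp
    hence "1 * ln (real (card \<S>)) \<le> r / (\<gamma> * \<delta> * real K) * ln (real (card \<S>))"
      using Z ZM by (intro mult_right_mono) auto
    moreover have "ln Z \<le> ln (real (card \<S>))" using Z ZM by simp
    moreover have "0 \<le> ln W" using W by simp
    moreover have "ln (1 - \<gamma>) \<le> 0" using \<gamma> by simp
    ultimately show ?thesis by linarith
  qed
  thus ?thesis by (simp add: Z_def W_def r_def C_def)
qed

text \<open>Jensen's inequality for the logarithm, through its tangent at the mean: by the definition of
  \<open>overlap_prob\<close> the mean number of signals near \<open>A\<close> is \<open>overlap_prob K \<S> \<delta> * card \<S>\<close>.\<close>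

lemma mean_log_card_near_le:
  assumes \<delta>: "0 \<le> \<delta>"
  shows "(\<Sum>A\<in>\<S>. ln (real (card (near \<delta> A)))) / real (card \<S>) \<le> ln (overlap_prob K \<S> \<delta> * real (card \<S>))"
proof -
  define M where "M = real (card \<S>)"
  define m where "m = overlap_prob K \<S> \<delta> * M"
  have M: "M > 0" using card_prior_pos by (simp add: M_def)
  have pos: "real (card (near \<delta> A)) > 0" if "A \<in> \<S>" for A
    using near_self[OF \<delta> that] finite_near by (auto simp: card_gt_0_iff)
  have m: "m = (\<Sum>A\<in>\<S>. real (card (near \<delta> A))) / M" by (simp add: m_def M_def overlap_prob_eq)
  have m_pos: "m > 0" unfolding m
    using M finite_prior nonempty pos by (intro divide_pos_pos sum_pos) auto
  have "(\<Sum>A\<in>\<S>. ln (real (card (near \<delta> A)))) \<le> (\<Sum>A\<in>\<S>. ln m - 1 + real (card (near \<delta> A)) / m)"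
  proof (rule sum_mono)
    fix A assume A: "A \<in> \<S>"
    have "ln (real (card (near \<delta> A)) / m) \<le> real (card (near \<delta> A)) / m - 1"
      using pos[OF A] m_pos by (intro ln_le_minus_one) simp
    thus "ln (real (card (near \<delta> A))) \<le> ln m - 1 + real (card (near \<delta> A)) / m"
      using pos[OF A] m_pos by (simp add: ln_div)
  qed
  also have "\<dots> = M * (ln m - 1) + (\<Sum>A\<in>\<S>. real (card (near \<delta> A))) / m"
    by (simp add: sum.distrib sum_divide_distrib[symmetric] M_def)
  also have "(\<Sum>A\<in>\<S>. real (card (near \<delta> A))) = M * m"
    using M by (simp add: m)
  also have "M * (ln m - 1) + (M * m) / m = M * ln m" using m_pos by (simp add: algebra_simps)
  finally show ?thesis using M by (simp add: m_def M_def[symmetric] field_simps)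
qed

text \<open>Average the pointwise bound over the planted model: the defect averages to the MMSE. Replica weak
  separation makes the first term small compared with \<open>ln (card \<S>)\<close>, so a small MMSE means
  that \<open>Y\<close> almost determines the signal.\<close>

lemma conditional_entropy_le:
  assumes p: "p \<in> {0..1}" and \<delta>: "0 < \<delta>" and \<gamma>: "0 < \<gamma>" "\<gamma> < 1"
  shows "conditional_entropy N K \<S> p \<le> ln (overlap_prob K \<S> \<delta> * real (card \<S>)) - ln (1 - \<gamma>)
           + MMSE N \<S> p / (\<gamma> * \<delta> * real K) * ln (real (card \<S>))"
proof -
  define M where "M = real (card \<S>)"
  define c where "c = ln M / (\<gamma> * \<delta> * real K)"
  define D where "D = (\<Sum>Y\<in>Pow {1..N}. likelihood N K p Y * (\<Sum>A\<in>compatible \<S> Y. posterior_defect Y A))"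
  have M: "M > 0" using card_prior_pos by (simp add: M_def)
  have MMSE: "MMSE N \<S> p = D / M"
    by (simp only: MMSE_eq_posterior_variance[OF p] posterior_variance_eq_defect D_def M_def)
  have "conditional_entropy N K \<S> p * M = (\<Sum>Y\<in>Pow {1..N}. likelihood N K p Y *
      (\<Sum>A\<in>compatible \<S> Y. ln (real (card (compatible \<S> Y)))))"
    using M by (simp add: conditional_entropy_def M_def)
  also have "\<dots> \<le> (\<Sum>Y\<in>Pow {1..N}. likelihood N K p Y *
      (\<Sum>A\<in>compatible \<S> Y. (ln (real (card (near \<delta> A))) - ln (1 - \<gamma>)) + c * posterior_defect Y A))"
    using log_card_compatible_le[OF _ \<delta> \<gamma>] likelihood_nonneg[OF p]
    by (intro sum_mono mult_left_mono) (auto simp: c_def M_def mult.commute)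
  also have "\<dots> = (\<Sum>Y\<in>Pow {1..N}. likelihood N K p Y *
      (\<Sum>A\<in>compatible \<S> Y. ln (real (card (near \<delta> A))) - ln (1 - \<gamma>))) + c * D"
    by (simp only: sum.distrib distrib_left D_def sum_distrib_left mult.left_commute[of c])
  also have "\<dots> = (\<Sum>A\<in>\<S>. ln (real (card (near \<delta> A)))) - M * ln (1 - \<gamma>) + c * D"
    unfolding sum_likelihood_compatible by (simp add: sum_subtractf M_def)
  finally have "conditional_entropy N K \<S> p \<le>
      (\<Sum>A\<in>\<S>. ln (real (card (near \<delta> A)))) / M - ln (1 - \<gamma>) + c * (D / M)"
    using M by (simp add: field_simps)
  also have "\<dots> \<le> ln (overlap_prob K \<S> \<delta> * M) - ln (1 - \<gamma>) + c * (D / M)"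
    using mean_log_card_near_le[of \<delta>] \<delta> by (simp add: M_def)
  finally show ?thesis unfolding MMSE[symmetric] by (simp add: c_def M_def mult_ac)
qed

end

section \<open>Asymptotics of the critical probability\<close>

lemma bernoulli_model_imp_uniform_prior: "bernoulli_model N K \<S> \<Longrightarrow> uniform_prior N K \<S>"
  by (simp add: bernoulli_model_def uniform_prior_def)

text \<open>All-or-nothing speaks about sequences \<open>p = p N\<close>, whereas integrating over \<open>p\<close> needs a bound at all
  \<open>p\<close> for one \<open>N\<close>. The passage is to test the sequence that picks a violating point whenever one
  exists.\<close>

lemma eventually_uniform_of_sequences:
  assumes seq: "\<And>x. \<forall>\<^sub>F n in F. P n (x n) \<Longrightarrow> \<forall>\<^sub>F n in F. Q n (x n)"
    and ex: "\<forall>\<^sub>F n in F. \<exists>x. P n x"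
  shows "\<forall>\<^sub>F n in F. \<forall>x. P n x \<longrightarrow> Q n x"
proof -
  define x where "x = (\<lambda>n. if \<exists>y. P n y \<and> \<not> Q n y then SOME y. P n y \<and> \<not> Q n y else SOME y. P n y)"
  have bad: "P n (x n) \<and> \<not> Q n (x n)" if "P n y" "\<not> Q n y" for n y
  proof -
    have "\<exists>y. P n y \<and> \<not> Q n y" using that by blast
    thus ?thesis by (simp add: x_def) (rule someI_ex)
  qed
  have good: "P n (x n)" if "P n y" for n y
  proof (cases "\<exists>y. P n y \<and> \<not> Q n y")
    case False
    hence "x n = (SOME y. P n y)" unfolding x_def by (rule if_not_P)
    thus ?thesis using that by (simp add: someI)
  qed (use bad in blast)
  have "\<forall>\<^sub>F n in F. P n (x n)" using ex by eventually_elim (use good in blast)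
  hence "\<forall>\<^sub>F n in F. Q n (x n)" by (rule seq)
  thus ?thesis by eventually_elim (use bad in blast)
qed

context
  fixes K :: "nat \<Rightarrow> nat" and \<S> :: "nat \<Rightarrow> nat set set" and p_AoN :: "nat \<Rightarrow> real"
  assumes model: "\<forall>\<^sub>F N in sequentially. uniform_prior N (K N) (\<S> N)"
    and RWS: "RWS K \<S>"
    and AoN: "exp_scale_AoN K \<S> p_AoN"
begin

lemma p_AoN_range: "\<forall>\<^sub>F N in sequentially. 0 < p_AoN N \<and> p_AoN N < 1"
  using AoN by (simp add: exp_scale_AoN_def)

lemma card_ge_2: "\<forall>\<^sub>F N in sequentially. card (\<S> N) \<ge> 2"
  using RWS by (simp add: RWS_def)

lemma eventually_MMSE_ge:
  assumes \<epsilon>: "0 < \<epsilon>" "\<epsilon> \<le> 1" and \<eta>: "0 < \<eta>"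
  shows "\<forall>\<^sub>F N in sequentially. \<forall>p. p \<in> {0..1} \<and> p \<ge> p_AoN N powr (1 - \<epsilon>) \<longrightarrow>
           (1 - \<eta>) * real (K N) \<le> MMSE N (\<S> N) p"
proof (rule eventually_uniform_of_sequences)
  fix p assume "\<forall>\<^sub>F N in sequentially. p N \<in> {0..1} \<and> p N \<ge> p_AoN N powr (1 - \<epsilon>)"
  hence "(\<lambda>N. MMSE N (\<S> N) (p N) / real (K N)) \<longlonglongrightarrow> 1"
    using AoN \<epsilon> unfolding exp_scale_AoN_def by blast
  hence "\<forall>\<^sub>F N in sequentially. 1 - \<eta> < MMSE N (\<S> N) (p N) / real (K N)"
    by (rule order_tendstoD) (use \<eta> in simp)
  thus "\<forall>\<^sub>F N in sequentially. (1 - \<eta>) * real (K N) \<le> MMSE N (\<S> N) (p N)"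
    using model
  proof eventually_elim
    case (elim N)
    have "real (K N) > 0" using uniform_prior.K_pos[OF elim(2)] by simp
    thus ?case using elim(1) by (simp add: field_simps)
  qed
next
  show "\<forall>\<^sub>F N in sequentially. \<exists>p. p \<in> {0..1} \<and> p \<ge> p_AoN N powr (1 - \<epsilon>)"
    using p_AoN_range
  proof eventually_elim
    case (elim N)
    have "p_AoN N powr (1 - \<epsilon>) \<le> 1" using elim \<epsilon> by (intro powr_le1) auto
    thus ?case by (intro exI[of _ 1]) simp
  qed
qed

text \<open>Above \<open>p_AoN powr (1 - t)\<close> the MMSE is nearly \<open>K\<close>, so the entropy gains at least about
  \<open>(1 - t) * K * (- ln p_AoN)\<close> on the way up to \<open>p = 1\<close>, where it is \<open>ln (card \<S>)\<close>.\<close>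

lemma log_p_AoN_le:
  assumes t: "0 < t" "t < 1"
  shows "\<forall>\<^sub>F N in sequentially. (1 - t)\<^sup>2 * (real (K N) * (- ln (p_AoN N))) \<le> ln (real (card (\<S> N)))"
proof -
  have "\<forall>\<^sub>F N in sequentially. \<forall>p. p \<in> {0..1} \<and> p \<ge> p_AoN N powr (1 - t) \<longrightarrow>
          (1 - t) * real (K N) \<le> MMSE N (\<S> N) p"
    using t by (intro eventually_MMSE_ge) auto
  thus ?thesis using model p_AoN_range
  proof eventually_elim
    case (elim N)
    interpret uniform_prior N "K N" "\<S> N" by (rule elim(2))
    define q where "q = p_AoN N powr (1 - t)"
    have q: "0 < q" "q \<le> 1" using elim(3) t by (auto simp: q_def intro: powr_le1)
    have "(1 - t) * real (K N) * (- ln q) \<le> ln (real (card (\<S> N)))"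
    proof (rule log_card_ge_of_MMSE_ge[OF q])
      fix p assume "q < p" "p < 1"
      thus "(1 - t) * real (K N) \<le> MMSE N (\<S> N) p"
        using elim(1) q by (auto simp: q_def[symmetric])
    qed
    moreover have "ln q = (1 - t) * ln (p_AoN N)" using elim(3) by (simp add: q_def ln_powr)
    ultimately show ?case by (simp add: power2_eq_square mult_ac)
  qed
qed

text \<open>At \<open>p = p_AoN powr (1 + t)\<close> the MMSE is negligible, so weak separation makes the conditional
  entropy negligible against \<open>ln (card \<S>)\<close>. The information bound says that this is possible only if
  \<open>K * (- ln p)\<close> is nearly as large as \<open>ln (card \<S>)\<close>.\<close>

lemma log_p_AoN_ge:
  assumes t: "0 < t"
  shows "\<forall>\<^sub>F N in sequentially.
           (1 - 3 * t) * ln (real (card (\<S> N))) \<le> (1 + t) * (real (K N) * (- ln (p_AoN N)))"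
proof -
  \<comment> \<open>Chosen so that \<open>- ln (1 - \<gamma>) = t * ln 2\<close>, which is at most \<open>t * ln (card (\<S> N))\<close> even if
    the number of signals stays bounded.\<close>
  define \<gamma> where "\<gamma> = 1 - exp (- t * ln 2 :: real)"
  have \<gamma>: "0 < \<gamma>" "\<gamma> < 1" using t by (auto simp: \<gamma>_def)
  define l where "l = (\<lambda>\<delta> N. 1 / ln (real (card (\<S> N))) *
          ln (overlap_prob (K N) (\<S> N) \<delta> * real (card (\<S> N))))"
  have "((\<lambda>\<delta>. limsup (\<lambda>N. ereal (l \<delta> N))) \<longlongrightarrow> 0) (at_right 0)"
    using RWS by (simp add: RWS_def l_def)
  hence "\<forall>\<^sub>F \<delta> in at_right 0. limsup (\<lambda>N. ereal (l \<delta> N)) < ereal t"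
    by (rule order_tendstoD) (use t in simp)
  hence "\<forall>\<^sub>F \<delta> in at_right (0 :: real). limsup (\<lambda>N. ereal (l \<delta> N)) < ereal t \<and> 0 < \<delta>"
    by (rule eventually_conj) (rule eventually_at_right_less)
  then obtain \<delta> where \<delta>: "limsup (\<lambda>N. ereal (l \<delta> N)) < ereal t" "0 < \<delta>"
    using eventually_happens'[OF trivial_limit_at_right_real] by blast
  have overlap: "\<forall>\<^sub>F N in sequentially. ereal (l \<delta> N) < ereal t"
    using \<delta>(1) by (rule Limsup_lessD)
  define p where "p = (\<lambda>N. p_AoN N powr (1 + t))"
  have "\<forall>\<^sub>F N in sequentially. p N \<in> {0..1} \<and> p N \<le> p_AoN N powr (1 + t)"
    using p_AoN_range by eventually_elim (use t in \<open>auto simp: p_def intro: powr_le1\<close>)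
  hence "(\<lambda>N. MMSE N (\<S> N) (p N) / real (K N)) \<longlonglongrightarrow> 0"
    using AoN t unfolding exp_scale_AoN_def by blast
  hence "\<forall>\<^sub>F N in sequentially. MMSE N (\<S> N) (p N) / real (K N) < t * (\<gamma> * \<delta>)"
    by (rule order_tendstoD) (use t \<gamma> \<delta> in simp)
  thus ?thesis using overlap model p_AoN_range card_ge_2
  proof eventually_elim
    case (elim N)
    interpret uniform_prior N "K N" "\<S> N" by (rule elim(3))
    define L where "L = ln (real (card (\<S> N)))"
    have L2: "ln 2 \<le> L" using elim(5) by (simp add: L_def)
    hence L: "L > 0" using ln_gt_zero[of "2::real"] by linarith
    have p: "0 < p N" "p N \<le> 1" using elim(4) t by (auto simp: p_def intro: powr_le1)
    have lnp: "ln (p N) = (1 + t) * ln (p_AoN N)" using elim(4) by (simp add: p_def ln_powr)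
    have "MMSE N (\<S> N) (p N) / (\<gamma> * \<delta> * real (K N)) \<le> t"
      using elim(1) \<gamma> \<delta> K_pos by (simp add: field_simps)
    hence "MMSE N (\<S> N) (p N) / (\<gamma> * \<delta> * real (K N)) * L \<le> t * L"
      using L by (intro mult_right_mono) auto
    moreover have "ln (overlap_prob (K N) (\<S> N) \<delta> * real (card (\<S> N))) \<le> t * L"
      using elim(2) L by (simp add: l_def L_def[symmetric] field_simps)
    moreover have "- ln (1 - \<gamma>) \<le> t * L"
      using L2 t by (simp add: \<gamma>_def)
    moreover have "conditional_entropy N (K N) (\<S> N) (p N) \<le>
        ln (overlap_prob (K N) (\<S> N) \<delta> * real (card (\<S> N))) - ln (1 - \<gamma>)
        + MMSE N (\<S> N) (p N) / (\<gamma> * \<delta> * real (K N)) * L"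
      unfolding L_def using p \<delta> \<gamma> by (intro conditional_entropy_le) auto
    moreover have "L + real (K N) * ln (p N) \<le> conditional_entropy N (K N) (\<S> N) (p N)"
      unfolding L_def by (rule conditional_entropy_ge[OF p])
    ultimately have "L + real (K N) * ln (p N) \<le> t * L + t * L + t * L" by linarith
    thus ?case by (simp add: lnp L_def[symmetric] algebra_simps)
  qed
qed

end

theorem theorem5p8:
  fixes K :: "nat \<Rightarrow> nat" and \<S> :: "nat \<Rightarrow> nat set set" and p_AoN :: "nat \<Rightarrow> real"
  assumes "\<forall>\<^sub>F N in sequentially. bernoulli_model N (K N) (\<S> N)"
    and "RWS K \<S>"
    and "exp_scale_AoN K \<S> p_AoN"
  shows "(\<lambda>N. ln (p_AoN N) / ln (p_1M (K N) (\<S> N))) \<longlonglongrightarrow> 1 \<and>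
    (\<exists>e :: nat \<Rightarrow> real. e \<longlonglongrightarrow> 0 \<and>
       (\<forall>\<^sub>F N in sequentially. p_AoN N = p_1M (K N) (\<S> N) powr (1 + e N)))"
proof -
  have model: "\<forall>\<^sub>F N in sequentially. uniform_prior N (K N) (\<S> N)"
    using assms(1) by eventually_elim (rule bernoulli_model_imp_uniform_prior)
  note hyps = model assms(2,3)
  define r where "r = (\<lambda>N. ln (p_AoN N) / ln (p_1M (K N) (\<S> N)))"
  have pos: "\<forall>\<^sub>F N in sequentially. 0 < p_AoN N \<and> 0 < real (K N) \<and> 0 < ln (real (card (\<S> N)))"
    using model p_AoN_range[OF hyps] card_ge_2[OF hyps]
  proof eventually_elim
    case (elim N)
    thus ?case using uniform_prior.K_pos[OF elim(1)] by simp
  qed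
  have r_eq: "\<forall>\<^sub>F N in sequentially. real (K N) * (- ln (p_AoN N)) = r N * ln (real (card (\<S> N)))"
    using pos by eventually_elim (simp add: r_def p_1M_def ln_powr field_simps)
  have lim: "r \<longlonglongrightarrow> 1"
  proof (rule order_tendstoI)
    fix a :: real assume a: "a < 1"
    \<comment> \<open>Small enough that the lower bound \<open>(1 - 3 * t) / (1 + t)\<close> for \<open>r\<close> exceeds \<open>a\<close>, also for
      negative \<open>a\<close>.\<close>
    define t where "t = (1 - a) / 8"
    have t: "0 < t" using a by (simp add: t_def)
    have "0 < (1 - a) * (5 - a) / 8" using a by simp
    also have "\<dots> = 1 - 3 * t - (1 + t) * a" by (simp add: t_def field_simps)
    finally have ta: "(1 + t) * a < 1 - 3 * t" by simp
    show "\<forall>\<^sub>F N in sequentially. a < r N"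
      using log_p_AoN_ge[OF hyps t] r_eq pos
    proof eventually_elim
      case (elim N)
      hence "(1 - 3 * t) * ln (real (card (\<S> N))) \<le> ((1 + t) * r N) * ln (real (card (\<S> N)))"
        by (simp only: mult.assoc)
      hence "1 - 3 * t \<le> (1 + t) * r N" using elim(3) mult_le_cancel_right_pos by blast
      hence "(1 + t) * a < (1 + t) * r N" using ta by linarith
      thus ?case using t by simp
    qed
  next
    fix a :: real assume a: "1 < a"
    \<comment> \<open>Small enough that the upper bound \<open>1 / (1 - t)\<^sup>2\<close> for \<open>r\<close> is below \<open>a\<close>.\<close>
    define t where "t = (a - 1) / (4 * a)"
    have t: "0 < t" "t < 1" using a by (auto simp: t_def field_simps)
    have "1 < a - 2 * t * a" using a by (simp add: t_def field_simps)
    also have "\<dots> \<le> (1 - t)\<^sup>2 * a" using a by (simp add: power2_eq_square algebra_simps)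
    finally have ta: "1 < (1 - t)\<^sup>2 * a" .
    show "\<forall>\<^sub>F N in sequentially. r N < a"
      using log_p_AoN_le[OF hyps t] r_eq pos
    proof eventually_elim
      case (elim N)
      hence "((1 - t)\<^sup>2 * r N) * ln (real (card (\<S> N))) \<le> 1 * ln (real (card (\<S> N)))"
        by (simp only: mult.assoc mult_1)
      hence "(1 - t)\<^sup>2 * r N \<le> 1" using elim(3) mult_le_cancel_right_pos by blast
      hence "(1 - t)\<^sup>2 * r N < (1 - t)\<^sup>2 * a" using ta by linarith
      thus ?case using t by simp
    qed
  qed
  have "(\<lambda>N. r N - 1) \<longlonglongrightarrow> 0" using tendsto_diff[OF lim tendsto_const[of 1]] by simp
  moreover have "\<forall>\<^sub>F N in sequentially. p_AoN N = p_1M (K N) (\<S> N) powr (1 + (r N - 1))"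
    using pos
  proof eventually_elim
    case (elim N)
    have "ln (p_1M (K N) (\<S> N)) \<noteq> 0" using elim by (simp add: p_1M_def ln_powr)
    moreover from this have "p_1M (K N) (\<S> N) \<noteq> 0" by auto
    ultimately show ?case using elim by (simp add: powr_def r_def)
  qed
  ultimately show ?thesis using lim unfolding r_def by blast
qed

end
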